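(* If $\hat f:L\to\mathbb{R}^M$ is a fixed point solution of the Local Lattice Boltzmann equation $$\hat f_j(x+e_j)=\mathcal{W}^x_j(\hat f(x),\alpha)\qquad\text{for } x\in L,\ j=1,\ldots,M,$$ the objective function $F$ is defined by $$F(\alpha)=\sum_{x\in L}F^x(\hat f(x)),$$ and $v:L\to\mathbb{R}^M$ is a solution of the equation $$v_k(x-e_k)=\sum_{j=1}^M v_j(x)\,\frac{\partial \mathcal{W}^x_j}{\partial f_k}(\hat f(x),\alpha)+\frac{\partial F^x}{\partial f_k}(\hat f(x))\qquad\text{for } x\in L,\ k=1,\ldots,M,$$ then the gradient of the objective function can be calculated as $$\frac{\partial F}{\partial\alpha}=\sum_{x\in L}\sum_{j=1}^M v_j(x)\,\frac{\partial \mathcal{W}^x_j}{\partial\alpha}(\hat f(x),\alpha).$$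
   Context: The lattice is the finite set $L=\{0,\ldots,L_x-1\}\times\{0,\ldots,L_y-1\}\times\{0,\ldots,L_z-1\}$. $M$ is a fixed number of densities per node, and a state of the system is a function $f:L\to\mathbb{R}^M$, with $f(x)=(f_1(x),\ldots,f_M(x))$. For $j=1,\ldots,M$, $e_j$ is the streaming vector, i.e. the shift of the $j$-th density from node $x$ to node $x+e_j$; the shifts $x+e_j$ and $x-e_j$ are periodic in all directions, i.e. addition and subtraction are taken modulo $L_x$, $L_y$ and $L_z$. $\mathbb{P}\subset\mathbb{R}^p$ is the parameter space and $\alpha\in\mathbb{P}$ denotes the optimization parameters. For each node $x\in L$, the collision operator $\mathcal{W}^x=(\mathcal{W}^x_1,\ldots,\mathcal{W}^x_M)$ assigns to the densities $f(x)\in\mathbb{R}^M$ at that node and the parameters $\alpha$ a vector $\mathcal{W}^x(f(x),\alpha)\in\mathbb{R}^M$; it may differ from node to node and does not depend on the densities at other nodes. $F^x$ is a node-dependent real-valued function of the densities at $x$. The stationary solution $\hat f$ implicitly depends on all parameters $\alpha$. Here $\partial\mathcal{W}^x_j/\partial f_k$ and $\partial F^x/\partial f_k$ are partial derivatives with respect to the $k$-th density, $\partial\mathcal{W}^x_j/\partial\alpha$ is the partial derivative with respect to the second argument of $\mathcal{W}^x_j$, and $\partial F/\partial\alpha$ is the derivative of $F(\alpha)$ taking into account the dependence of $\hat f$ on $\alpha$.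
   Formalization: The smoothness left implicit is assumed: at the point considered, each collision operator is jointly differentiable in densities and parameters, each F^x is differentiable, and the stationary solution (a fixed point for every parameter in the parameter space) depends differentiably on α. *)

theory Defs
  imports "HOL-Analysis.Analysis"
begin

type_synonym node = "int \<times> int \<times> int"

definition lattice :: "nat \<Rightarrow> nat \<Rightarrow> nat \<Rightarrow> node set" where
  "lattice Lx Ly Lz = {0..<int Lx} \<times> {0..<int Ly} \<times> {0..<int Lz}"

definition wrap :: "nat \<Rightarrow> nat \<Rightarrow> nat \<Rightarrow> node \<Rightarrow> node" where
  "wrap Lx Ly Lz = (\<lambda>(a, b, c). (a mod int Lx, b mod int Ly, c mod int Lz))"

definition partial_deriv :: "(real ^ 'n \<Rightarrow> real) \<Rightarrow> 'n \<Rightarrow> real ^ 'n \<Rightarrow> real" where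
  "partial_deriv f k a = deriv (\<lambda>t. f (a + t *\<^sub>R axis k 1)) 0"

(* The derivative is taken relative to S so that points on the boundary of a parameter space
   are covered. If a is an interior point of S, the gradient is unique and is the D with
   GDERIV f a :> D; otherwise an arbitrary relative gradient is selected. *)
definition gradient_within :: "('a::real_inner \<Rightarrow> real) \<Rightarrow> 'a set \<Rightarrow> 'a \<Rightarrow> 'a" where
  "gradient_within f S a = (SOME D. (f has_derivative (\<lambda>h. h \<bullet> D)) (at a within S))"

end

theory Submission
  imports Defs
begin

text \<open>
  Adding to the objective the constraint residuals weighted by the multipliers \<open>v\<close> leaves it
  unchanged on \<open>P\<close>. In the derivative of this Lagrangian, shifting the streaming term back to its
  node of origin makes \<open>v (x - e k) $ k\<close> the coefficient of the variation of \<open>fhat\<close>; the adjoint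
  equation cancels it, and only the explicit dependence of \<open>W\<close> on the parameters survives.
  Working with the Lagrangian instead of differentiating the constraint on both sides matters:
  derivatives within \<open>P\<close> need not be unique, so the two sides could have different ones.
\<close>

text \<open>The node \<open>x\<close> serves only to make all three side lengths positive:
  \<open>mod\<close> by 0 is the identity and would leave the range.\<close>

lemma wrap_in_lattice:
  assumes "x \<in> lattice Lx Ly Lz"
  shows "wrap Lx Ly Lz y \<in> lattice Lx Ly Lz"
  using assms by (auto simp: lattice_def wrap_def split: prod.splits)

lemma wrap_wrap_add: "wrap Lx Ly Lz (wrap Lx Ly Lz x + d) = wrap Lx Ly Lz (x + d)"
  by (cases x; cases d) (simp add: wrap_def mod_simps)

lemma wrap_wrap_diff: "wrap Lx Ly Lz (wrap Lx Ly Lz x - d) = wrap Lx Ly Lz (x - d)"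
  by (cases x; cases d) (simp add: wrap_def mod_simps)

lemma wrap_lattice: "x \<in> lattice Lx Ly Lz \<Longrightarrow> wrap Lx Ly Lz x = x"
  by (auto simp: lattice_def wrap_def)

text \<open>The periodic shift by \<open>d\<close> permutes the lattice, with the shift by
  \<open>-d\<close> as its inverse. This is the discrete summation by parts that moves the streaming
  from the state onto the multipliers.\<close>

lemma sum_lattice_shift:
  fixes g :: "node \<Rightarrow> node \<Rightarrow> 'a::comm_monoid_add"
  shows "(\<Sum>x\<in>lattice Lx Ly Lz. g x (wrap Lx Ly Lz (x + d))) =
    (\<Sum>y\<in>lattice Lx Ly Lz. g (wrap Lx Ly Lz (y - d)) y)"
  by (rule sum.reindex_bij_witness[where i = "\<lambda>y. wrap Lx Ly Lz (y - d)"
        and j = "\<lambda>x. wrap Lx Ly Lz (x + d)"])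
     (auto simp: wrap_wrap_add wrap_wrap_diff wrap_lattice intro: wrap_in_lattice)

text \<open>The chain rule along each coordinate line identifies the one-dimensional
  \<open>deriv\<close> with the value of \<open>f'\<close> on that axis; linearity does the
  rest.\<close>

lemma has_derivative_partial_deriv:
  fixes f :: "real ^ 'n::finite \<Rightarrow> real"
  assumes "(f has_derivative f') (at a)"
  shows "f' h = (\<Sum>k\<in>UNIV. h $ k * partial_deriv f k a)"
proof -
  interpret f': bounded_linear f' using assms by (rule has_derivative_bounded_linear)
  have partial: "partial_deriv f k a = f' (axis k 1)" for k
  proof -
    have "((\<lambda>t. a + t *\<^sub>R axis k 1) has_derivative (\<lambda>t. t *\<^sub>R axis k 1)) (at 0)"
      by (auto intro!: derivative_eq_intros)
    then have "((\<lambda>t. f (a + t *\<^sub>R axis k 1)) has_derivative (\<lambda>t. f' (t *\<^sub>R axis k 1))) (at 0)"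
      by (rule has_derivative_compose) (simp add: assms)
    then have "((\<lambda>t. f (a + t *\<^sub>R axis k 1)) has_real_derivative f' (axis k 1)) (at 0)"
      by (simp add: has_field_derivative_def f'.scaleR mult_commute_abs)
    then show ?thesis unfolding partial_deriv_def by (rule DERIV_imp_deriv)
  qed
  have "h = (\<Sum>k\<in>UNIV. h $ k *\<^sub>R axis k 1)"
    by (simp add: vec_eq_iff axis_def if_distrib[where f = "\<lambda>x. _ * x"] cong: if_cong)
  then have "f' h = f' (\<Sum>k\<in>UNIV. h $ k *\<^sub>R axis k 1)" by simp
  then show ?thesis by (simp add: f'.sum f'.scaleR partial)
qed

text \<open>By Riesz representation, a linear functional is the inner product with its adjoint
  applied to 1, so the choice in \<open>gradient_within\<close> has a witness.\<close>

lemma has_derivative_gradient_within: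
  fixes f :: "'a::euclidean_space \<Rightarrow> real"
  assumes "f differentiable (at a within S)"
  shows "(f has_derivative (\<lambda>h. h \<bullet> gradient_within f S a)) (at a within S)"
proof -
  from assms obtain f' where f': "(f has_derivative f') (at a within S)"
    by (auto simp: differentiable_def)
  then have "linear f'" by (intro bounded_linear.linear has_derivative_bounded_linear)
  then have "f' = (\<lambda>h. h \<bullet> adjoint f' 1)" by (auto simp: adjoint_works)
  with f' have "(f has_derivative (\<lambda>h. h \<bullet> adjoint f' 1)) (at a within S)" by simp
  then show ?thesis unfolding gradient_within_def by (rule someI)
qed

text \<open>Covers both freezing one argument of \<open>w\<close> and moving both along a curve. The
  domain \<open>T\<close> is separate from \<open>S\<close> because the state may vary freely while
  the parameter stays in \<open>S\<close>.\<close>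

lemma has_derivative_compose_Pair:
  assumes "((\<lambda>(g, b). w g b) has_derivative w') (at (p y, q y) within UNIV \<times> S)"
    and "(p has_derivative p') (at y within T)" "(q has_derivative q') (at y within T)"
    and "q ` T \<subseteq> S"
  shows "((\<lambda>y. w (p y) (q y)) has_derivative (\<lambda>h. w' (p' h, q' h))) (at y within T)"
proof -
  have "((\<lambda>(g, b). w g b) has_derivative w') (at (p y, q y) within (\<lambda>y. (p y, q y)) ` T)"
    using assms(4) by (intro has_derivative_subset[OF assms(1)]) auto
  from has_derivative_in_compose[OF has_derivative_Pair[OF assms(2,3)] this]
  show ?thesis by simp
qed

text \<open>Linearity splits the total derivative \<open>w' (u' h, h)\<close> into
  \<open>w' (u' h, 0)\<close>, which is expanded in partial derivatives, and
  \<open>w' (0, h)\<close>, which is traded for the selected gradient.\<close>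

lemma has_derivative_two_arguments:
  fixes w :: "real ^ 'm::finite \<Rightarrow> 'a::euclidean_space \<Rightarrow> real"
  assumes w: "(\<lambda>(g, \<beta>). w g \<beta>) differentiable (at (u a, a) within UNIV \<times> S)"
    and u: "(u has_derivative u') (at a within S)" and a: "a \<in> S"
  shows "((\<lambda>\<beta>. w (u \<beta>) \<beta>) has_derivative
      (\<lambda>h. (\<Sum>k\<in>UNIV. u' h $ k * partial_deriv (\<lambda>g. w g a) k (u a))
        + h \<bullet> gradient_within (w (u a)) S a)) (at a within S)"
proof -
  from w obtain w' where w': "((\<lambda>(g, \<beta>). w g \<beta>) has_derivative w') (at (u a, a) within UNIV \<times> S)"
    by (auto simp: differentiable_def)
  interpret w': bounded_linear w' using w' by (rule has_derivative_bounded_linear)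
  \<comment> \<open>The parameter is frozen at \<open>a\<close>, which lies in \<open>S\<close>, so
    here \<open>T\<close> can be all of \<open>UNIV\<close> and the derivative is
    unrestricted.\<close>
  have state: "((\<lambda>g. w g a) has_derivative (\<lambda>h. w' (h, 0))) (at (u a))"
    by (rule has_derivative_compose_Pair[OF w' has_derivative_ident has_derivative_const])
       (use a in auto)
  have par: "(w (u a) has_derivative (\<lambda>h. w' (0, h))) (at a within S)"
    by (rule has_derivative_compose_Pair[OF w' has_derivative_const has_derivative_ident]) simp
  have "((\<lambda>\<beta>. w (u \<beta>) \<beta>) has_derivative (\<lambda>h. w' (u' h, h))) (at a within S)"
    by (rule has_derivative_compose_Pair[where p = u, OF w' u has_derivative_ident]) simp
  \<comment> \<open>The selected gradient may differ from the one induced by \<open>w'\<close>, but both are derivatives of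
    \<open>w (u a)\<close> within \<open>S\<close>, so exchanging one for the other is harmless.\<close>
  moreover have "(w (u a) has_derivative (\<lambda>h. h \<bullet> gradient_within (w (u a)) S a)) (at a within S)"
    using par by (intro has_derivative_gradient_within differentiableI)
  ultimately have "((\<lambda>\<beta>. w (u \<beta>) \<beta> + w (u a) \<beta> - w (u a) \<beta>) has_derivative
      (\<lambda>h. w' (u' h, h) + h \<bullet> gradient_within (w (u a)) S a - w' (0, h))) (at a within S)"
    using par by (intro has_derivative_add has_derivative_diff)
  moreover have "w' (u' h, h) - w' (0, h) =
      (\<Sum>k\<in>UNIV. u' h $ k * partial_deriv (\<lambda>g. w g a) k (u a))" for h
    using has_derivative_partial_deriv[OF state, of "u' h"] by (simp flip: w'.diff)
  ultimately show ?thesis by (simp add: algebra_simps)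
qed

theorem theorem1:
  fixes Lx Ly Lz :: nat
    and L :: "node set"
    and e :: "'m::finite \<Rightarrow> node"
    and P :: "(real ^ 'p::finite) set"
    and \<alpha> :: "real ^ 'p"
    and W :: "node \<Rightarrow> real ^ 'm \<Rightarrow> real ^ 'p \<Rightarrow> real ^ 'm"
    and Fx :: "node \<Rightarrow> real ^ 'm \<Rightarrow> real"
    and fhat :: "real ^ 'p \<Rightarrow> node \<Rightarrow> real ^ 'm"
    and F :: "real ^ 'p \<Rightarrow> real"
    and v :: "node \<Rightarrow> real ^ 'm"
  assumes L: "L = lattice Lx Ly Lz"
    and param: "\<alpha> \<in> P"
    and W_diff: "\<And>x. x \<in> L \<Longrightarrow>
        (\<lambda>(g, \<beta>). W x g \<beta>) differentiable (at (fhat \<alpha> x, \<alpha>) within UNIV \<times> P)"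
    and Fx_diff: "\<And>x. x \<in> L \<Longrightarrow> Fx x differentiable (at (fhat \<alpha> x))"
    and fhat_diff: "\<And>x. x \<in> L \<Longrightarrow> (\<lambda>\<beta>. fhat \<beta> x) differentiable (at \<alpha> within P)"
    and fixed_point: "\<And>\<beta> x j. \<beta> \<in> P \<Longrightarrow> x \<in> L \<Longrightarrow>
        fhat \<beta> (wrap Lx Ly Lz (x + e j)) $ j = W x (fhat \<beta> x) \<beta> $ j"
    and objective: "\<And>\<beta>. \<beta> \<in> P \<Longrightarrow> F \<beta> = (\<Sum>x\<in>L. Fx x (fhat \<beta> x))"
    and adjoint: "\<And>x k. x \<in> L \<Longrightarrow>
        v (wrap Lx Ly Lz (x - e k)) $ k =
          (\<Sum>j\<in>UNIV. v x $ j * partial_deriv (\<lambda>g. W x g \<alpha> $ j) k (fhat \<alpha> x))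
          + partial_deriv (Fx x) k (fhat \<alpha> x)"
  shows "(F has_derivative
      (\<lambda>h. h \<bullet> (\<Sum>x\<in>L. \<Sum>j\<in>UNIV.
              v x $ j *\<^sub>R gradient_within (\<lambda>\<beta>. W x (fhat \<alpha> x) \<beta> $ j) P \<alpha>)))
    (at \<alpha> within P)"
proof -
  define s where "s x = wrap Lx Ly Lz x" for x
  define dW where "dW x j k = partial_deriv (\<lambda>g. W x g \<alpha> $ j) k (fhat \<alpha> x)" for x j k
  define dF where "dF x k = partial_deriv (Fx x) k (fhat \<alpha> x)" for x k
  define G where "G x j = gradient_within (\<lambda>\<beta>. W x (fhat \<alpha> x) \<beta> $ j) P \<alpha>" for x j
  \<comment> \<open>Derivatives within \<open>P\<close> need not be unique; any choice will do,
    since \<open>f'\<close> cancels in the end.\<close>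
  from fhat_diff obtain f' where f':
    "\<And>x. x \<in> L \<Longrightarrow> ((\<lambda>\<beta>. fhat \<beta> x) has_derivative f' x) (at \<alpha> within P)"
    unfolding differentiable_def by metis
  have s_L: "s y \<in> L" if "x \<in> L" for x y
    using that wrap_in_lattice by (simp add: L s_def)
  have dF': "((\<lambda>\<beta>. Fx x (fhat \<beta> x)) has_derivative (\<lambda>h. \<Sum>k\<in>UNIV. f' x h $ k * dF x k))
      (at \<alpha> within P)" if x: "x \<in> L" for x
  proof -
    from Fx_diff[OF x] obtain D where D: "(Fx x has_derivative D) (at (fhat \<alpha> x))"
      by (auto simp: differentiable_def)
    show ?thesis
      using has_derivative_compose[OF f'[OF x] D] has_derivative_partial_deriv[OF D]
      by (simp add: dF_def)
  qed
  have dW': "((\<lambda>\<beta>. W x (fhat \<beta> x) \<beta> $ j) has_derivative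
      (\<lambda>h. (\<Sum>k\<in>UNIV. f' x h $ k * dW x j k) + h \<bullet> G x j)) (at \<alpha> within P)" if x: "x \<in> L" for x j
  proof -
    have "(\<lambda>y. (case y of (g, \<beta>) \<Rightarrow> W x g \<beta>) $ j) differentiable
        (at (fhat \<alpha> x, \<alpha>) within UNIV \<times> P)"
      using W_diff[OF x] by (auto simp: differentiable_def intro: bounded_linear.has_derivative
          [OF bounded_linear_vec_nth])
    then have "(\<lambda>(g, \<beta>). W x g \<beta> $ j) differentiable (at (fhat \<alpha> x, \<alpha>) within UNIV \<times> P)"
      by (simp add: case_prod_beta')
    from has_derivative_two_arguments[OF this f'[OF x] param]
    show ?thesis by (simp add: dW_def G_def)
  qed
  have stream: "((\<lambda>\<beta>. fhat \<beta> (s (x + e j)) $ j) has_derivative (\<lambda>h. f' (s (x + e j)) h $ j))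
      (at \<alpha> within P)" if x: "x \<in> L" for x j
    using f'[OF s_L[OF x]] by (rule bounded_linear.has_derivative[OF bounded_linear_vec_nth])
  let ?lagrangian = "\<lambda>\<beta>. \<Sum>x\<in>L. Fx x (fhat \<beta> x)
      + (\<Sum>j\<in>UNIV. v x $ j * (W x (fhat \<beta> x) \<beta> $ j - fhat \<beta> (s (x + e j)) $ j))"
  let ?D = "\<lambda>h. \<Sum>x\<in>L. (\<Sum>k\<in>UNIV. f' x h $ k * dF x k)
      + (\<Sum>j\<in>UNIV. v x $ j * ((\<Sum>k\<in>UNIV. f' x h $ k * dW x j k) + h \<bullet> G x j
          - f' (s (x + e j)) h $ j))"
  have lagrangian: "(?lagrangian has_derivative ?D) (at \<alpha> within P)"
    by (intro has_derivative_sum has_derivative_add has_derivative_diff has_derivative_mult_right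
        dF' dW' stream)
  have eq: "?lagrangian \<beta> = F \<beta>" if "\<beta> \<in> P" for \<beta>
    using that by (simp add: objective fixed_point s_def)
  \<comment> \<open>Agreement on \<open>P\<close> alone suffices, because the derivative is taken
    within \<open>P\<close> and \<alpha> belongs to \<open>P\<close>.\<close>
  have F: "(F has_derivative ?D) (at \<alpha> within P)"
    by (rule has_derivative_transform[OF param _ lagrangian]) (simp only: eq)
  have "?D h = h \<bullet> (\<Sum>x\<in>L. \<Sum>j\<in>UNIV. v x $ j *\<^sub>R G x j)" for h
  proof -
    have "(\<Sum>x\<in>L. \<Sum>j\<in>UNIV. v x $ j * f' (s (x + e j)) h $ j)
        = (\<Sum>j\<in>UNIV. \<Sum>x\<in>L. v x $ j * f' (s (x + e j)) h $ j)"
      by (rule sum.swap)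
    \<comment> \<open>For each fixed \<open>j\<close> the shift by \<open>e j\<close> is the same at
      all nodes, hence the preceding swap of the sums.\<close>
    also have "\<dots> = (\<Sum>j\<in>UNIV. \<Sum>x\<in>L. v (s (x - e j)) $ j * f' x h $ j)"
      unfolding L s_def
      by (intro sum.cong refl sum_lattice_shift[where g = "\<lambda>x y. v x $ _ * f' y h $ _"])
    also have "\<dots> = (\<Sum>x\<in>L. \<Sum>k\<in>UNIV. v (s (x - e k)) $ k * f' x h $ k)"
      by (rule sum.swap)
    also have "\<dots> = (\<Sum>x\<in>L. \<Sum>k\<in>UNIV. ((\<Sum>j\<in>UNIV. v x $ j * dW x j k) + dF x k) * f' x h $ k)"
      by (simp add: s_def adjoint dW_def dF_def)
    also have "\<dots> = (\<Sum>x\<in>L. (\<Sum>k\<in>UNIV. \<Sum>j\<in>UNIV. v x $ j * dW x j k * f' x h $ k)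
        + (\<Sum>k\<in>UNIV. f' x h $ k * dF x k))"
      by (simp add: distrib_right sum.distrib sum_distrib_right mult.commute[of "dF _ _"])
    \<comment> \<open>With \<open>j\<close> outermost, these are exactly the \<open>dW\<close> and
      \<open>dF\<close> terms of \<open>?D\<close>, from which the streaming term is
      subtracted.\<close>
    also have "\<dots> = (\<Sum>x\<in>L. (\<Sum>j\<in>UNIV. \<Sum>k\<in>UNIV. v x $ j * dW x j k * f' x h $ k)
        + (\<Sum>k\<in>UNIV. f' x h $ k * dF x k))"
      by (intro sum.cong arg_cong2[where f = "(+)"] refl sum.swap)
    finally have "(\<Sum>x\<in>L. \<Sum>j\<in>UNIV. v x $ j * f' (s (x + e j)) h $ j) = \<dots>" .
    then show ?thesis
      by (simp add: sum.distrib sum_subtractf right_diff_distrib distrib_left sum_distrib_left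
          inner_sum_right mult_ac)
  qed
  with F show ?thesis by (simp add: G_def)
qed

end
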